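(* Let $(X,\mathcal{F}_X)$ be a stratified space and let $A$ be a subspace of $X$. Then $$\mathrm{Whcat}(X,A,\mathcal{F}_X)=\mathrm{Gcat}(X,A,\mathcal{F}_X).$$
   Context: A stratified space $(X,\mathcal{F}_X)$ is a topological space $X$ together with a partition $\mathcal{F}_X$ of $X$ whose elements (called strata) are path-connected subspaces of $X$. A stratified map between spaces with partitions is a continuous map sending any two points of a common stratum of the source to points of a common stratum of the target. The product $(X,\mathcal{F}_X)\times(Y,\mathcal{F}_Y)$ has as strata the products $S\times S'$ of strata. The interval $I=[0,1]$ carries the trivial partition $\mathcal{F}_I=\{[0,1]\}$. If $A\subseteq X$ is a subspace, the induced stratification $\mathcal{F}_A$ has for strata the connected components of the intersections $A\cap S$, $S\in\mathcal{F}_X$; $(X,A,\mathcal{F}_X)$ is called a stratified pair. Two stratified maps $f,g\colon (X,\mathcal{F}_X)\to (Y,\mathcal{F}_Y)$ are $\mathcal{S}$-homotopic if there is a stratified map $H\colon (X,\mathcal{F}_X)\times (I,\mathcal{F}_I)\to (Y,\mathcal{F}_Y)$ with $f=H(-,0)$ and $g=H(-,1)$. Ganea category. Let $(X,\mathcal{F}_X)^I$ be the set of continuous paths $\omega\colon I\to X$ whose image $\omega(I)$ is contained in a single stratum of $\mathcal{F}_X$ (with the topology induced from the path space $X^I$), partitioned into the subsets $S^I$, $S\in\mathcal{F}_X$. The $i$th Ganea space $G_i(X,A)$ is the set of $(i+1)$-tuples $(\alpha_1,\ldots,\alpha_{i+1})$ of paths in $(X,\mathcal{F}_X)^I$ such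 that $\alpha_1(1)=\cdots=\alpha_{i+1}(1)$ and there exists $k$, $1\le k\le i+1$, with $\alpha_k(0)\in A$. It is endowed with the stratification induced from the product stratification on $((X,\mathcal{F}_X)^I)^{i+1}$, and the resulting stratified space is denoted $G_i(X,A,\mathcal{F}_X)$. The $i$th Ganea fibration $g_i\colon G_i(X,A,\mathcal{F}_X)\to(X,\mathcal{F}_X)$ is $g_i(\alpha_1,\ldots,\alpha_{i+1})=\alpha_1(1)$. $\mathrm{Gcat}(X,A,\mathcal{F}_X)$ is the least integer $n\ge 0$ such that $g_n$ has a stratified section ($\infty$ if there is none). Whitehead category. The $i$th fat wedge $T_i(X,A)$ is the subset of $X^{i+1}$ of elements $(x_1,\ldots,x_{i+1})$ such that there exists $k$, $1\le k\le i+1$, with $x_k\in A$. It is endowed with the stratification induced from the product $(X,\mathcal{F}_X)^{i+1}$ and denoted $T_i(X,A,\mathcal{F}_X)$. $\mathrm{Whcat}(X,A,\mathcal{F}_X)$ is the least integer $n\ge 0$ such that the diagonal $\Delta\colon(X,\mathcal{F}_X)\to(X,\mathcal{F}_X)^{n+1}$ factors up to $\mathcal{S}$-homotopy through the inclusion $t_n\colon T_n(X,A,\mathcal{F}_X)\to(X,\mathcal{F}_X)^{n+1}$, i.e. there is a stratified map $r\colon(X,\mathcal{F}_X)\to T_n(X,A,\mathcal{F}_X)$ with $t_n\circ r$ $\mathcal{S}$-homotopic to $\Delta$ ($\infty$ if there is none). *)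

theory Defs
  imports "HOL-Analysis.Analysis"
begin

section \<open>Spaces with partitions and stratified maps\<close>

definition stratified_space :: "'a topology \<Rightarrow> 'a set set \<Rightarrow> bool" where
  "stratified_space X F \<longleftrightarrow>
     partition_on (topspace X) F \<and> (\<forall>S\<in>F. path_connectedin X S)"

text \<open>Source and target are only spaces with partitions here: the connected components in
  \<open>induced_strata\<close> need not be path-connected.\<close>

definition stratified_map ::
    "'a topology \<Rightarrow> 'a set set \<Rightarrow> 'b topology \<Rightarrow> 'b set set \<Rightarrow> ('a \<Rightarrow> 'b) \<Rightarrow> bool" where
  "stratified_map X F Y G f \<longleftrightarrow>
     continuous_map X Y f \<and>
     (\<forall>S\<in>F. \<forall>x\<in>S. \<forall>y\<in>S. \<exists>T\<in>G. f x \<in> T \<and> f y \<in> T)"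

definition prod_strata :: "'a set set \<Rightarrow> 'b set set \<Rightarrow> ('a \<times> 'b) set set" where
  "prod_strata F G = {S \<times> T | S T. S \<in> F \<and> T \<in> G}"

text \<open>A \<open>k\<close>-tuple is an extensional function on \<open>{1..k}\<close>, as in \<^const>\<open>product_topology\<close>.\<close>

definition power_topology :: "'a topology \<Rightarrow> nat \<Rightarrow> (nat \<Rightarrow> 'a) topology" where
  "power_topology X k = product_topology (\<lambda>_. X) {1..k}"

definition power_strata :: "'a set set \<Rightarrow> nat \<Rightarrow> (nat \<Rightarrow> 'a) set set" where
  "power_strata F k = {PiE {1..k} S | S. \<forall>j\<in>{1..k}. S j \<in> F}"

definition induced_strata :: "'a topology \<Rightarrow> 'a set set \<Rightarrow> 'a set \<Rightarrow> 'a set set" where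
  "induced_strata X F A = (\<Union>S\<in>F. connected_components_of (subtopology X (A \<inter> S)))"

abbreviation interval_topology :: "real topology" where
  "interval_topology \<equiv> top_of_set {0..1}"

definition interval_strata :: "real set set" where
  "interval_strata = {{0..1}}"

definition S_homotopic ::
    "'a topology \<Rightarrow> 'a set set \<Rightarrow> 'b topology \<Rightarrow> 'b set set \<Rightarrow> ('a \<Rightarrow> 'b) \<Rightarrow> ('a \<Rightarrow> 'b) \<Rightarrow> bool" where
  "S_homotopic X F Y G f g \<longleftrightarrow>
     (\<exists>H. stratified_map (prod_topology X interval_topology) (prod_strata F interval_strata) Y G H \<and>
          (\<forall>x\<in>topspace X. H (x, 0) = f x \<and> H (x, 1) = g x))"

section \<open>Stratified paths\<close>

text \<open>The compact-open topology. Maps are taken extensional on the source, so that two maps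
  agreeing on \<open>topspace X\<close> are the same point; the choice \<open>K = {}\<close> shows that the carrier
  consists of all such continuous maps.\<close>

definition compact_open_topology :: "'a topology \<Rightarrow> 'b topology \<Rightarrow> ('a \<Rightarrow> 'b) topology" where
  "compact_open_topology X Y = topology_generated_by
     {{f \<in> extensional (topspace X). continuous_map X Y f \<and> f ` K \<subseteq> U} | K U.
        compactin X K \<and> openin Y U}"

definition paths_in :: "'a topology \<Rightarrow> 'a set \<Rightarrow> (real \<Rightarrow> 'a) set" where
  "paths_in X S =
     {\<omega> \<in> extensional {0..1}. continuous_map interval_topology X \<omega> \<and> \<omega> ` {0..1} \<subseteq> S}"

definition strat_paths :: "'a topology \<Rightarrow> 'a set set \<Rightarrow> (real \<Rightarrow> 'a) set" where
  "strat_paths X F = (\<Union>S\<in>F. paths_in X S)"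

definition strat_path_topology :: "'a topology \<Rightarrow> 'a set set \<Rightarrow> (real \<Rightarrow> 'a) topology" where
  "strat_path_topology X F =
     subtopology (compact_open_topology interval_topology X) (strat_paths X F)"

definition path_strata :: "'a topology \<Rightarrow> 'a set set \<Rightarrow> (real \<Rightarrow> 'a) set set" where
  "path_strata X F = paths_in X ` F"

section \<open>Ganea category\<close>

definition ganea_set :: "'a topology \<Rightarrow> 'a set set \<Rightarrow> 'a set \<Rightarrow> nat \<Rightarrow> (nat \<Rightarrow> real \<Rightarrow> 'a) set" where
  "ganea_set X F A i =
     {\<alpha> \<in> PiE {1..i+1} (\<lambda>_. strat_paths X F).
        (\<forall>j\<in>{1..i+1}. \<forall>k\<in>{1..i+1}. \<alpha> j 1 = \<alpha> k 1) \<and> (\<exists>k\<in>{1..i+1}. \<alpha> k 0 \<in> A)}"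

definition ganea_topology ::
    "'a topology \<Rightarrow> 'a set set \<Rightarrow> 'a set \<Rightarrow> nat \<Rightarrow> (nat \<Rightarrow> real \<Rightarrow> 'a) topology" where
  "ganea_topology X F A i =
     subtopology (power_topology (strat_path_topology X F) (i+1)) (ganea_set X F A i)"

definition ganea_strata ::
    "'a topology \<Rightarrow> 'a set set \<Rightarrow> 'a set \<Rightarrow> nat \<Rightarrow> (nat \<Rightarrow> real \<Rightarrow> 'a) set set" where
  "ganea_strata X F A i =
     induced_strata (power_topology (strat_path_topology X F) (i+1))
       (power_strata (path_strata X F) (i+1)) (ganea_set X F A i)"

definition ganea_fibration :: "(nat \<Rightarrow> real \<Rightarrow> 'a) \<Rightarrow> 'a" where
  "ganea_fibration \<alpha> = \<alpha> 1 1"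

definition has_ganea_section :: "'a topology \<Rightarrow> 'a set set \<Rightarrow> 'a set \<Rightarrow> nat \<Rightarrow> bool" where
  "has_ganea_section X F A n \<longleftrightarrow>
     (\<exists>\<sigma>. stratified_map X F (ganea_topology X F A n) (ganea_strata X F A n) \<sigma> \<and>
          (\<forall>x\<in>topspace X. ganea_fibration (\<sigma> x) = x))"

definition Gcat :: "'a topology \<Rightarrow> 'a set set \<Rightarrow> 'a set \<Rightarrow> enat" where
  "Gcat X F A =
     (if \<exists>n. has_ganea_section X F A n then enat (LEAST n. has_ganea_section X F A n) else \<infinity>)"

section \<open>Whitehead category\<close>

definition fat_wedge :: "'a topology \<Rightarrow> 'a set \<Rightarrow> nat \<Rightarrow> (nat \<Rightarrow> 'a) set" where
  "fat_wedge X A i = {x \<in> PiE {1..i+1} (\<lambda>_. topspace X). \<exists>k\<in>{1..i+1}. x k \<in> A}"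

definition fat_wedge_topology :: "'a topology \<Rightarrow> 'a set \<Rightarrow> nat \<Rightarrow> (nat \<Rightarrow> 'a) topology" where
  "fat_wedge_topology X A i = subtopology (power_topology X (i+1)) (fat_wedge X A i)"

definition fat_wedge_strata :: "'a topology \<Rightarrow> 'a set set \<Rightarrow> 'a set \<Rightarrow> nat \<Rightarrow> (nat \<Rightarrow> 'a) set set" where
  "fat_wedge_strata X F A i =
     induced_strata (power_topology X (i+1)) (power_strata F (i+1)) (fat_wedge X A i)"

definition diagonal :: "nat \<Rightarrow> 'a \<Rightarrow> nat \<Rightarrow> 'a" where
  "diagonal k x = (\<lambda>j\<in>{1..k}. x)"

text \<open>The inclusion of the fat wedge is the identity on underlying functions, so its composite
  with \<open>r\<close> is again \<open>r\<close>, now regarded as a map into the full power.\<close>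

definition diagonal_factors :: "'a topology \<Rightarrow> 'a set set \<Rightarrow> 'a set \<Rightarrow> nat \<Rightarrow> bool" where
  "diagonal_factors X F A n \<longleftrightarrow>
     (\<exists>r. stratified_map X F (fat_wedge_topology X A n) (fat_wedge_strata X F A n) r \<and>
          S_homotopic X F (power_topology X (n+1)) (power_strata F (n+1)) r (diagonal (n+1)))"

definition Whcat :: "'a topology \<Rightarrow> 'a set set \<Rightarrow> 'a set \<Rightarrow> enat" where
  "Whcat X F A =
     (if \<exists>n. diagonal_factors X F A n then enat (LEAST n. diagonal_factors X F A n) else \<infinity>)"

end

theory Submission
  imports Defs
begin

text \<open>
  For each \<open>n\<close> the map \<open>g\<^sub>n\<close> has a stratified section if and only if the diagonal of \<open>X\<^sup>n\<^sup>+\<^sup>1\<close>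
  factors through the fat wedge, so the two invariants are least elements of the same set. The
  correspondence is the exponential law applied in each coordinate: a section \<open>\<sigma>\<close> and a homotopy
  \<open>H\<close> ending at the diagonal determine each other by \<open>\<sigma>(x)\<^sub>j(t) = H(x,t)\<^sub>j\<close>. That the paths \<open>\<sigma>(x)\<^sub>j\<close>
  end at \<open>x\<close> says that \<open>H(-,1)\<close> is the diagonal, and that one of them starts in \<open>A\<close> says that
  \<open>H(-,0)\<close> takes values in the fat wedge.

  Two points need care. The first is that the exponential law is compatible with stratifications
  (\<open>stratified_map_curry\<close>, \<open>stratified_map_uncurry\<close>). Since strata are disjoint, a stratified map
  sends a whole stratum \<open>S \<times> I\<close> into one stratum, which is the same as sending \<open>S\<close> into one stratum
  of paths. Topologically, currying rests on the tube lemma and uncurrying on the local compactness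
  of the interval.

  The second is that the Ganea space and the fat wedge carry the stratification by connected
  components, which is finer than the one by traces of the ambient strata. A stratified map out of
  \<open>X\<close> does not see the difference (\<open>stratified_map_into_induced_iff\<close>): strata of \<open>X\<close> are connected,
  so their images lie in single components. Hence being stratified into either subspace just means
  being stratified into the ambient power and taking values in the subspace.
\<close>

section \<open>Stratified maps\<close>

lemma stratified_map_common_stratum:
  assumes "stratified_map X F Y G f" and "S \<in> F" and "x \<in> S" and "y \<in> S"
  obtains T where "T \<in> G" and "f x \<in> T" and "f y \<in> T"
  using assms unfolding stratified_map_def by blast

lemma stratified_map_compose:
  assumes "stratified_map X F Y G f" and "stratified_map Y G Z H g"
  shows "stratified_map X F Z H (\<lambda>x. g (f x))"
  using assms continuous_map_compose[of X Y f Z g]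
  unfolding stratified_map_def comp_def by metis

text \<open>The definition of a stratified map compares points two at a time; disjointness of the target
  strata makes the common stratum independent of the pair.\<close>

lemma stratified_map_image_stratum:
  assumes "stratified_map X F Y G f" and "disjoint G" and "S \<in> F" and "S \<noteq> {}"
  obtains T where "T \<in> G" and "f ` S \<subseteq> T"
proof -
  obtain x where x: "x \<in> S"
    using assms by blast
  then obtain T where T: "T \<in> G" "f x \<in> T"
    using stratified_map_common_stratum[OF assms(1,3) x x] by blast
  have "f y \<in> T" if y: "y \<in> S" for y
  proof -
    obtain T' where "T' \<in> G" "f x \<in> T'" "f y \<in> T'"
      using stratified_map_common_stratum[OF assms(1,3) x y] .
    then show ?thesis
      using T assms(2) by (metis disjnt_iff pairwiseD)
  qed
  then show thesis
    using that T by blast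
qed

text \<open>Connectedness of the source strata makes the passage to connected components in the induced
  stratification invisible to maps into a subspace.\<close>

lemma stratified_map_into_induced_iff:
  assumes X: "stratified_space X F" and G: "disjoint G"
  shows "stratified_map X F (subtopology Y B) (induced_strata Y G B) f \<longleftrightarrow>
    stratified_map X F Y G f \<and> f \<in> topspace X \<rightarrow> B" (is "?L \<longleftrightarrow> ?R")
proof
  assume L: ?L
  have trace: "\<exists>T\<in>G. C \<subseteq> T" if C: "C \<in> induced_strata Y G B" for C
  proof -
    obtain T where "T \<in> G" "C \<in> connected_components_of (subtopology Y (B \<inter> T))"
      using C unfolding induced_strata_def by blast
    moreover from this have "C \<subseteq> topspace (subtopology Y (B \<inter> T))"
      by (intro connected_components_of_subset)
    ultimately show ?thesis
      by auto
  qed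
  have "\<exists>T\<in>G. f x \<in> T \<and> f y \<in> T" if S: "S \<in> F" "x \<in> S" "y \<in> S" for S x y
  proof -
    obtain C where C: "C \<in> induced_strata Y G B" "f x \<in> C" "f y \<in> C"
      using stratified_map_common_stratum[OF L S] .
    then show ?thesis
      using trace[OF C(1)] by blast
  qed
  with L show ?R
    unfolding stratified_map_def continuous_map_in_subtopology
    by (simp add: image_subset_iff_funcset)
next
  assume R: ?R
  then have cont: "continuous_map X Y f"
    unfolding stratified_map_def by simp
  have "\<exists>C\<in>induced_strata Y G B. f x \<in> C \<and> f y \<in> C" if S: "S \<in> F" and xy: "x \<in> S" "y \<in> S" for S x y
  proof -
    \<comment> \<open>The whole image of \<open>S\<close> lies in one ambient stratum, so its connectedness passes to the trace
      of that stratum on \<open>B\<close>, whose components are the induced strata.\<close>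
    have SX: "S \<subseteq> topspace X" and "connectedin X S"
      using X S path_connectedin_imp_connectedin
      unfolding stratified_space_def partition_on_def by blast+
    then have conn: "connectedin Y (f ` S)"
      using cont connectedin_continuous_map_image by blast
    obtain T where T: "T \<in> G" "f ` S \<subseteq> T"
      using stratified_map_image_stratum[OF _ G S] R xy by blast
    define Z where "Z = subtopology Y (B \<inter> T)"
    have conn: "connectedin Z (f ` S)"
      using conn T(2) R SX unfolding Z_def connectedin_subtopology by blast
    define C where "C = connected_component_of_set Z (f x)"
    have "f ` S \<subseteq> C"
      unfolding C_def by (rule connected_component_of_maximal[OF conn]) (use xy in blast)
    moreover have "C \<in> connected_components_of Z"
      unfolding connected_components_of_def C_def
      using connectedin_subset_topspace[OF conn] xy by blast
    ultimately show ?thesis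
      using T(1) xy unfolding induced_strata_def Z_def by blast
  qed
  with R cont show ?L
    unfolding stratified_map_def continuous_map_in_subtopology
    by (simp add: image_subset_iff_funcset)
qed

lemma disjoint_power_strata:
  assumes "disjoint G"
  shows "disjoint (power_strata G k)"
proof (rule disjointI)
  fix a b assume "a \<in> power_strata G k" "b \<in> power_strata G k" and ne: "a \<noteq> b"
  then obtain S T where ST: "a = PiE {1..k} S" "b = PiE {1..k} T"
    "\<forall>j\<in>{1..k}. S j \<in> G" "\<forall>j\<in>{1..k}. T j \<in> G"
    unfolding power_strata_def by blast
  show "a \<inter> b = {}"
  proof (rule ccontr)
    assume "a \<inter> b \<noteq> {}"
    then obtain z where z: "z \<in> a" "z \<in> b"
      by blast
    then have "S j = T j" if "j \<in> {1..k}" for j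
      using that ST assms disjointD by (metis PiE_mem disjoint_iff)
    then show False
      using ST ne PiE_cong by metis
  qed
qed

lemma stratified_map_componentwise:
  assumes F: "\<Union>F \<subseteq> topspace X"
  shows "stratified_map X F (power_topology Y k) (power_strata G k) f \<longleftrightarrow>
    f \<in> topspace X \<rightarrow> extensional {1..k} \<and> (\<forall>j\<in>{1..k}. stratified_map X F Y G (\<lambda>x. f x j))"
    (is "?L \<longleftrightarrow> ?R")
proof
  assume L: ?L
  have "\<exists>T\<in>G. f x j \<in> T \<and> f y j \<in> T" if S: "S \<in> F" "x \<in> S" "y \<in> S" and j: "j \<in> {1..k}" for S x y j
  proof -
    obtain P where "P \<in> power_strata G k" "f x \<in> P" "f y \<in> P"
      using stratified_map_common_stratum[OF L S] .
    moreover from this obtain T where "P = PiE {1..k} T" "\<forall>j\<in>{1..k}. T j \<in> G"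
      unfolding power_strata_def by blast
    ultimately show ?thesis
      using j PiE_mem by metis
  qed
  moreover have "f \<in> topspace X \<rightarrow> extensional {1..k}"
      "\<forall>j\<in>{1..k}. continuous_map X Y (\<lambda>x. f x j)"
    using L unfolding stratified_map_def power_topology_def continuous_map_componentwise
    by (simp_all add: image_subset_iff_funcset)
  ultimately show ?R
    unfolding stratified_map_def by simp
next
  assume R: ?R
  have "\<exists>P\<in>power_strata G k. f x \<in> P \<and> f y \<in> P" if S: "S \<in> F" "x \<in> S" "y \<in> S" for S x y
  proof -
    have "\<exists>T\<in>G. f x j \<in> T \<and> f y j \<in> T" if "j \<in> {1..k}" for j
      using R that stratified_map_common_stratum[OF _ S, of X Y G "\<lambda>x. f x j"] by metis
    then obtain T where T: "\<forall>j\<in>{1..k}. T j \<in> G \<and> f x j \<in> T j \<and> f y j \<in> T j"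
      by metis
    moreover have "f x \<in> extensional {1..k}" "f y \<in> extensional {1..k}"
      using R S F by blast+
    ultimately have "f x \<in> PiE {1..k} T" "f y \<in> PiE {1..k} T"
      by (auto simp: PiE_iff)
    then show ?thesis
      using T unfolding power_strata_def by blast
  qed
  moreover have "continuous_map X (power_topology Y k) f"
    using R unfolding stratified_map_def power_topology_def continuous_map_componentwise
    by (simp add: image_subset_iff_funcset)
  ultimately show ?L
    unfolding stratified_map_def by simp
qed

section \<open>The exponential law for the compact-open topology\<close>

lemma compact_open_subbasic_open:
  assumes "compactin X K" and "openin Y U"
  shows "openin (compact_open_topology X Y)
    {f \<in> extensional (topspace X). continuous_map X Y f \<and> f ` K \<subseteq> U}"
  unfolding compact_open_topology_def by (rule topology_generated_by_Basis) (use assms in blast)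

lemma topspace_compact_open:
  "topspace (compact_open_topology X Y) = {f \<in> extensional (topspace X). continuous_map X Y f}"
proof -
  have "compactin X {}" "openin Y {}"
    by auto
  then show ?thesis
    unfolding compact_open_topology_def topology_generated_by_topspace by blast
qed

text \<open>If the slice \<open>{x} \<times> K\<close> over a compact set \<open>K\<close> is mapped into an open set, then by the tube
  lemma so are all slices over points near \<open>x\<close>.\<close>

lemma continuous_map_curry:
  assumes h: "continuous_map (prod_topology X Y) Z h"
  shows "continuous_map X (compact_open_topology Y Z) (\<lambda>x. \<lambda>t\<in>topspace Y. h (x, t))" (is "continuous_map _ _ ?c")
proof -
  have slice: "continuous_map Y Z (\<lambda>t. h (x, t))" if "x \<in> topspace X" for x
    using continuous_map_compose[OF _ h, of Y "\<lambda>t. (x, t)"] that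
    by (simp add: comp_def continuous_map_pairwise)
  have c: "?c x \<in> extensional (topspace Y)" "continuous_map Y Z (?c x)" if "x \<in> topspace X" for x
    using slice[OF that] by (auto intro: continuous_map_eq)
  have "openin X {x \<in> topspace X. ?c x ` K \<subseteq> U}" if K: "compactin Y K" and U: "openin Z U" for K U
  proof (subst openin_subopen, intro ballI)
    fix x assume x: "x \<in> {x \<in> topspace X. ?c x ` K \<subseteq> U}"
    have KY: "K \<subseteq> topspace Y"
      using K compactin_subset_topspace by blast
    define W where "W = {p \<in> topspace (prod_topology X Y). h p \<in> U}"
    have W: "openin (prod_topology X Y) W"
      unfolding W_def using h U openin_continuous_map_preimage by blast
    have sub: "{x} \<times> K \<subseteq> W"
      unfolding W_def using x KY by (auto simp: image_subset_iff subset_iff)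
    obtain V V' where V: "openin X V" "x \<in> V" "K \<subseteq> V'" "V \<times> V' \<subseteq> W"
      using tube_lemma_right[OF W K _ sub] x by blast
    have "V \<subseteq> {x \<in> topspace X. ?c x ` K \<subseteq> U}"
      using V KY openin_subset[OF V(1)] unfolding W_def by auto
    then show "\<exists>T. openin X T \<and> x \<in> T \<and> T \<subseteq> {x \<in> topspace X. ?c x ` K \<subseteq> U}"
      using V by blast
  qed
  moreover have "?c -` {f \<in> extensional (topspace Y). continuous_map Y Z f \<and> f ` K \<subseteq> U} \<inter> topspace X
      = {x \<in> topspace X. ?c x ` K \<subseteq> U}" for K U
    using c by blast
  moreover have "?c ` topspace X \<subseteq> topspace (compact_open_topology Y Z)"
    using c unfolding topspace_compact_open by blast
  ultimately show ?thesis
    unfolding compact_open_topology_def continuous_on_generated_topo_iff topology_generated_by_topspace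
    by auto
qed

text \<open>If \<open>f(t)\<close> lies in an open set \<open>U\<close>, local compactness gives a compact neighbourhood \<open>K\<close> of \<open>t\<close>
  mapped into \<open>U\<close> by \<open>f\<close>; all maps in the subbasic set given by \<open>K\<close> and \<open>U\<close> then send \<open>K\<close> into \<open>U\<close>.\<close>

lemma continuous_map_evaluation:
  assumes Y: "neighbourhood_base_of (compactin Y) Y"
  shows "continuous_map (prod_topology (compact_open_topology Y Z) Y) Z (\<lambda>p. fst p (snd p))"
    (is "continuous_map ?P _ ?e")
proof -
  have "openin ?P {p \<in> topspace ?P. ?e p \<in> U}" if U: "openin Z U" for U
  proof (subst openin_subopen, intro ballI)
    fix p assume p: "p \<in> {p \<in> topspace ?P. ?e p \<in> U}"
    obtain f t where ft: "p = (f, t)"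
      by (cases p)
    have f: "f \<in> extensional (topspace Y)" "continuous_map Y Z f" and t: "t \<in> topspace Y" "f t \<in> U"
      using p by (auto simp: ft topspace_compact_open)
    have "openin Y {s \<in> topspace Y. f s \<in> U}"
      using f U openin_continuous_map_preimage by blast
    moreover have "t \<in> {s \<in> topspace Y. f s \<in> U}"
      using t by blast
    ultimately obtain V K where VK: "openin Y V" "compactin Y K" "t \<in> V" "V \<subseteq> K"
        "K \<subseteq> {s \<in> topspace Y. f s \<in> U}"
      using Y unfolding neighbourhood_base_of by meson
    define W where "W = {f \<in> extensional (topspace Y). continuous_map Y Z f \<and> f ` K \<subseteq> U}"
    have "openin (compact_open_topology Y Z) W"
      unfolding W_def using VK U compact_open_subbasic_open by blast
    then have "openin ?P (W \<times> V)"
      using VK by (simp add: openin_prod_Times_iff)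
    moreover have "p \<in> W \<times> V"
      using VK f by (auto simp: ft W_def)
    moreover have "W \<times> V \<subseteq> {p \<in> topspace ?P. ?e p \<in> U}"
      using VK(4) openin_subset[OF VK(1)]
      by (auto simp: W_def topspace_compact_open image_subset_iff)
    ultimately show "\<exists>T. openin ?P T \<and> p \<in> T \<and> T \<subseteq> {p \<in> topspace ?P. ?e p \<in> U}"
      by blast
  qed
  moreover have "?e \<in> topspace ?P \<rightarrow> topspace Z"
    by (auto simp: topspace_compact_open continuous_map_def)
  ultimately show ?thesis
    unfolding continuous_map_def by blast
qed

lemma neighbourhood_base_compact_interval:
  "neighbourhood_base_of (compactin interval_topology) interval_topology"
proof -
  have "compact_space interval_topology"
    by (simp add: compact_space_subtopology)
  moreover have "Hausdorff_space interval_topology"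
    by (simp add: Hausdorff_space_subtopology)
  ultimately show ?thesis
    using compact_imp_locally_compact_space locally_compact_space_neighbourhood_base by blast
qed

section \<open>The exponential law for stratified paths\<close>

lemma disjoint_path_strata:
  assumes "disjoint G"
  shows "disjoint (path_strata Y G)"
proof (rule disjointI)
  fix a b assume "a \<in> path_strata Y G" "b \<in> path_strata Y G" and ne: "a \<noteq> b"
  then obtain S T where ST: "a = paths_in Y S" "b = paths_in Y T" "S \<in> G" "T \<in> G"
    unfolding path_strata_def by blast
  then have "S \<inter> T = {}"
    using ne assms disjointD by metis
  moreover have "\<omega> 0 \<in> S \<inter> T" if "\<omega> \<in> a" "\<omega> \<in> b" for \<omega>
    using that unfolding ST paths_in_def by (auto simp: image_subset_iff)
  ultimately show "a \<inter> b = {}"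
    by blast
qed

text \<open>All paths \<open>H(x,-)\<close> with \<open>x\<close> in a stratum \<open>S\<close> stay in the stratum containing \<open>H(S \<times> I)\<close>. That each
  \<open>x\<close> lies in some stratum makes these paths stratified at all.\<close>

lemma stratified_map_curry:
  assumes F: "partition_on (topspace X) F" and G: "disjoint G"
    and H: "stratified_map (prod_topology X interval_topology) (prod_strata F interval_strata) Y G H"
  shows "stratified_map X F (strat_path_topology Y G) (path_strata Y G) (\<lambda>x. \<lambda>t\<in>{0..1}. H (x, t))"
    (is "stratified_map _ _ _ _ ?c")
proof -
  have cont: "continuous_map X (compact_open_topology interval_topology Y) ?c"
    using H continuous_map_curry[of X interval_topology Y H] unfolding stratified_map_def by simp
  have mem: "\<exists>T\<in>G. ?c ` S \<subseteq> paths_in Y T" if S: "S \<in> F" for S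
  proof -
    have "S \<noteq> {}" and SX: "S \<subseteq> topspace X"
      using F S unfolding partition_on_def by auto
    moreover have "S \<times> {0..1} \<in> prod_strata F interval_strata"
      using S unfolding prod_strata_def interval_strata_def by blast
    ultimately obtain T where T: "T \<in> G" "H ` (S \<times> {0..1}) \<subseteq> T"
      using stratified_map_image_stratum[OF H G, of "S \<times> {0..1}"] by force
    have "?c x \<in> paths_in Y T" if "x \<in> S" for x
    proof -
      have "?c x \<in> topspace (compact_open_topology interval_topology Y)"
        using cont that SX unfolding continuous_map_def by blast
      moreover have "?c x ` {0..1} \<subseteq> T"
        using T(2) that by (simp add: image_subset_iff)
      ultimately show ?thesis
        unfolding topspace_compact_open paths_in_def by simp
    qed
    then show ?thesis
      using T by blast
  qed
  have "?c x \<in> strat_paths Y G" if x: "x \<in> topspace X" for x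
  proof -
    obtain S where "S \<in> F" "x \<in> S"
      using F x unfolding partition_on_def by blast
    then show ?thesis
      using mem unfolding strat_paths_def by blast
  qed
  then have "continuous_map X (strat_path_topology Y G) ?c"
    using cont unfolding strat_path_topology_def continuous_map_in_subtopology
    by (simp add: image_subset_iff)
  moreover have "\<exists>P\<in>path_strata Y G. ?c x \<in> P \<and> ?c y \<in> P" if "S \<in> F" "x \<in> S" "y \<in> S" for S x y
    using mem[OF that(1)] that(2,3) unfolding path_strata_def by blast
  ultimately show ?thesis
    unfolding stratified_map_def by simp
qed

lemma stratified_map_uncurry:
  assumes h: "stratified_map X F (strat_path_topology Y G) (path_strata Y G) h"
  shows "stratified_map (prod_topology X interval_topology) (prod_strata F interval_strata) Y G
    (\<lambda>p. h (fst p) (snd p))"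
proof -
  let ?P = "prod_topology X interval_topology" and ?C = "compact_open_topology interval_topology Y"
  have "continuous_map X ?C h"
    using h unfolding stratified_map_def strat_path_topology_def continuous_map_in_subtopology by blast
  then have "continuous_map ?P ?C (\<lambda>p. h (fst p))"
    using continuous_map_compose[OF continuous_map_fst] unfolding comp_def by blast
  then have "continuous_map ?P (prod_topology ?C interval_topology) (\<lambda>p. (h (fst p), snd p))"
    using continuous_map_snd[of X interval_topology] by (simp add: continuous_map_paired)
  from continuous_map_compose[OF this continuous_map_evaluation[OF neighbourhood_base_compact_interval]]
  have "continuous_map ?P Y (\<lambda>p. h (fst p) (snd p))"
    by (simp add: comp_def)
  moreover have "\<exists>T\<in>G. h x s \<in> T \<and> h y t \<in> T"
    if S: "S \<in> F" "x \<in> S" "y \<in> S" and st: "s \<in> {0..1}" "t \<in> {0..1}" for S x y s t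
  proof -
    obtain T where "T \<in> G" "h x \<in> paths_in Y T" "h y \<in> paths_in Y T"
      using stratified_map_common_stratum[OF h S] unfolding path_strata_def by blast
    then show ?thesis
      using st unfolding paths_in_def by blast
  qed
  ultimately show ?thesis
    unfolding stratified_map_def prod_strata_def interval_strata_def by fastforce
qed

lemma stratified_map_slice:
  assumes "t \<in> {0..1}"
  shows "stratified_map X F (prod_topology X interval_topology) (prod_strata F interval_strata) (\<lambda>x. (x, t))"
proof -
  have "continuous_map X (prod_topology X interval_topology) (\<lambda>x. (x, t))"
    using assms by (simp add: continuous_map_pairwise comp_def)
  moreover have "(x, t) \<in> S \<times> {0..1}" if "x \<in> S" for x S
    using assms that by simp
  moreover have "S \<times> {0..1} \<in> prod_strata F interval_strata" if "S \<in> F" for S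
    using that unfolding prod_strata_def interval_strata_def by blast
  ultimately show ?thesis
    unfolding stratified_map_def by metis
qed

section \<open>Sections of the Ganea fibrations and factorizations of the diagonal\<close>

text \<open>In both directions \<open>\<sigma>(x)\<^sub>j(t) = H(x,t)\<^sub>j\<close>, and \<open>r\<close> is the tuple of starting points \<open>\<sigma>(x)\<^sub>j(0)\<close>.\<close>

lemma has_ganea_section_iff_diagonal_factors:
  assumes X: "stratified_space X F"
  shows "has_ganea_section X F A n \<longleftrightarrow> diagonal_factors X F A n"
proof -
  let ?J = "{1..n+1}"
  let ?XI = "prod_topology X interval_topology" and ?FI = "prod_strata F interval_strata"
  let ?M = "power_topology X (n+1)" and ?N = "power_strata F (n+1)"
  let ?PM = "power_topology (strat_path_topology X F) (n+1)"
  let ?PN = "power_strata (path_strata X F) (n+1)"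
  have part: "partition_on (topspace X) F"
    using X unfolding stratified_space_def by blast
  then have UF: "\<Union>F \<subseteq> topspace X" and disj: "disjoint F"
    unfolding partition_on_def by auto
  have UFI: "\<Union>?FI \<subseteq> topspace ?XI"
    using UF unfolding prod_strata_def interval_strata_def by auto
  have ganea: "stratified_map X F (ganea_topology X F A n) (ganea_strata X F A n) \<sigma> \<longleftrightarrow>
      stratified_map X F ?PM ?PN \<sigma> \<and> \<sigma> \<in> topspace X \<rightarrow> ganea_set X F A n" for \<sigma>
    unfolding ganea_topology_def ganea_strata_def
    by (intro stratified_map_into_induced_iff X disjoint_power_strata disjoint_path_strata disj)
  have wedge: "stratified_map X F (fat_wedge_topology X A n) (fat_wedge_strata X F A n) r \<longleftrightarrow>
      stratified_map X F ?M ?N r \<and> r \<in> topspace X \<rightarrow> fat_wedge X A n" for r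
    unfolding fat_wedge_topology_def fat_wedge_strata_def
    by (intro stratified_map_into_induced_iff X disjoint_power_strata disj)
  show ?thesis
  proof
    assume "has_ganea_section X F A n"
    then obtain \<sigma> where \<sigma>: "stratified_map X F ?PM ?PN \<sigma>"
        and mem: "\<And>x. x \<in> topspace X \<Longrightarrow> \<sigma> x \<in> ganea_set X F A n"
        and sec: "\<And>x. x \<in> topspace X \<Longrightarrow> \<sigma> x 1 1 = x"
      unfolding has_ganea_section_def ganea ganea_fibration_def by blast
    define H where "H = (\<lambda>p. \<lambda>j\<in>?J. \<sigma> (fst p) j (snd p))"
    have "stratified_map ?XI ?FI X F (\<lambda>p. \<sigma> (fst p) j (snd p))" if "j \<in> ?J" for j
      using \<sigma> that stratified_map_uncurry[of X F X F "\<lambda>x. \<sigma> x j"]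
      unfolding stratified_map_componentwise[OF UF] by blast
    then have H: "stratified_map ?XI ?FI ?M ?N H"
      unfolding stratified_map_componentwise[OF UFI] H_def by auto
    have "stratified_map X F ?M ?N (\<lambda>x. H (x, 0))"
      using stratified_map_compose[OF stratified_map_slice H] by simp
    moreover have "H (x, 0) \<in> fat_wedge X A n" if x: "x \<in> topspace X" for x
    proof -
      have "H (x, 0) \<in> topspace ?M"
        using H x unfolding stratified_map_def continuous_map_def by auto
      then show ?thesis
        using mem[OF x] unfolding fat_wedge_def ganea_set_def power_topology_def H_def by auto
    qed
    moreover have "H (x, 1) = diagonal (n+1) x" if x: "x \<in> topspace X" for x
    proof -
      have "\<forall>j\<in>?J. \<forall>k\<in>?J. \<sigma> x j 1 = \<sigma> x k 1"
        using mem[OF x] unfolding ganea_set_def by blast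
      moreover have "1 \<in> ?J"
        by simp
      ultimately have "\<sigma> x j 1 = x" if "j \<in> ?J" for j
        using that sec[OF x] by metis
      then show ?thesis
        unfolding H_def diagonal_def by (intro restrict_ext) simp
    qed
    ultimately show "diagonal_factors X F A n"
      unfolding diagonal_factors_def wedge S_homotopic_def using H
      by (intro exI[of _ "\<lambda>x. H (x, 0)"] exI[of _ H] conjI) auto
  next
    assume "diagonal_factors X F A n"
    then obtain r H where H: "stratified_map ?XI ?FI ?M ?N H"
        and r: "\<And>x. x \<in> topspace X \<Longrightarrow> r x \<in> fat_wedge X A n"
        and ends: "\<And>x. x \<in> topspace X \<Longrightarrow> H (x, 0) = r x"
          "\<And>x. x \<in> topspace X \<Longrightarrow> H (x, 1) = diagonal (n+1) x"
      unfolding diagonal_factors_def wedge S_homotopic_def by blast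
    define \<sigma> where "\<sigma> = (\<lambda>x. \<lambda>j\<in>?J. \<lambda>t\<in>{0..1::real}. H (x, t) j)"
    have "stratified_map X F (strat_path_topology X F) (path_strata X F) (\<lambda>x. \<lambda>t\<in>{0..1}. H (x, t) j)"
      if "j \<in> ?J" for j
      using H that stratified_map_curry[OF part disj, of X "\<lambda>p. H p j"]
      unfolding stratified_map_componentwise[OF UFI] by blast
    then have \<sigma>: "stratified_map X F ?PM ?PN \<sigma>"
      unfolding stratified_map_componentwise[OF UF] \<sigma>_def by auto
    have end1: "\<sigma> x j 1 = x" if "x \<in> topspace X" "j \<in> ?J" for x j
      using that ends unfolding \<sigma>_def diagonal_def by auto
    have "\<sigma> x \<in> ganea_set X F A n" if x: "x \<in> topspace X" for x
    proof -
      have "\<sigma> x \<in> topspace ?PM"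
        using \<sigma> x unfolding stratified_map_def continuous_map_def by auto
      then have "\<sigma> x \<in> PiE ?J (\<lambda>_. strat_paths X F)"
        unfolding power_topology_def strat_path_topology_def by auto
      moreover have "\<exists>k\<in>?J. \<sigma> x k 0 \<in> A"
        using r[OF x] ends(1)[OF x] unfolding fat_wedge_def \<sigma>_def by auto
      ultimately show ?thesis
        using end1[OF x] unfolding ganea_set_def by auto
    qed
    moreover have "ganea_fibration (\<sigma> x) = x" if "x \<in> topspace X" for x
      using end1[OF that] unfolding ganea_fibration_def by simp
    ultimately show "has_ganea_section X F A n"
      unfolding has_ganea_section_def ganea using \<sigma> by blast
  qed
qed

theorem theorem2:
  fixes X :: "'a topology" and F :: "'a set set" and A :: "'a set"
  assumes "stratified_space X F" and "A \<subseteq> topspace X"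
  shows "Whcat X F A = Gcat X F A"
  unfolding Whcat_def Gcat_def has_ganea_section_iff_diagonal_factors[OF assms(1)] ..

end
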